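(* Given $t\in(0,\infty)^m$, $f\in(0,1]^m$, positive integer application costs $g\in\mathbb{N}^m$ and a positive integer budget $H\in\mathbb{N}$, the dynamic programming algorithm $\mathsf{D}$ described in the context produces an optimal application portfolio for Ellis's problem $$\text{maximize } v(\mathcal{X})\quad\text{subject to }\mathcal{X}\subseteq\{1,\dots,m\},\ \sum_{j\in\mathcal{X}}g_j\le H$$ in $O(Hm+m\log m)$ time.
   Context: Let $Z_1,\dots,Z_m$ be independent Bernoulli random variables with $\Pr(Z_j=1)=f_j$, let $t_0=0$, and let $v(\mathcal{X})=\operatorname{E}\bigl[\max\{t_0,\max\{t_jZ_j:j\in\mathcal{X}\}\}\bigr]$, $v(\varnothing)=0$. It is assumed that $g_j\le H$ for each $j$ and $\sum_jg_j>H$. Running time counts arithmetic operations and comparisons on numbers as unit time. Algorithm $\mathsf{D}$. (1) Index the schools so that $t_1\le\cdots\le t_m$. (2) Fill a lookup table with the values $V[j,h]$ for $0\le j\le m$, $0\le h\le H$, defined by $V[j,h]=0$ if $j=0$ or $h=0$, and $$V[j,h]=\max\bigl\{V[j-1,h],\ (1-f_j)V[j-1,h-g_j]+f_jt_j\bigr\}$$ for $1\le j\le m$, $1\le h\le H$, with the conventions $V[j,h]=-\infty$ for $h<0$ and $-\infty\cdot0=-\infty$. (3) Set $h\gets H$, $\mathcal{X}\gets\varnothing$. For $j=m,m-1,\dots,1$: if $V[j-1,h]<V[j,h]$, set $\mathcal{X}\gets\mathcal{X}\cup\{j\}$ and $h\gets h-g_j$. (4) Return $\mathcal{X}$. *)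

theory Defs
  imports "HOL-Probability.Probability" "HOL-Library.State_Monad"
begin

section \<open>Ellis's problem\<close>

text \<open>
  Schools are numbered \<open>1, \<dots>, m\<close>; the values of \<open>t\<close>, \<open>f\<close>, \<open>g\<close> and \<open>Z\<close> outside this range
  are irrelevant.
\<close>

definition ellis_instance ::
  "nat \<Rightarrow> (nat \<Rightarrow> real) \<Rightarrow> (nat \<Rightarrow> real) \<Rightarrow> (nat \<Rightarrow> nat) \<Rightarrow> nat \<Rightarrow> bool" where
  "ellis_instance m t f g H \<longleftrightarrow>
     (\<forall>j\<in>{1..m}. 0 < t j) \<and>
     (\<forall>j\<in>{1..m}. 0 < f j \<and> f j \<le> 1) \<and>
     (\<forall>j\<in>{1..m}. 0 < g j \<and> g j \<le> H) \<and>
     0 < H \<and>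
     H < (\<Sum>j\<in>{1..m}. g j)"

definition indep_bernoulli ::
  "nat \<Rightarrow> (nat \<Rightarrow> real) \<Rightarrow> 'w measure \<Rightarrow> (nat \<Rightarrow> 'w \<Rightarrow> real) \<Rightarrow> bool" where
  "indep_bernoulli m f M Z \<longleftrightarrow>
     prob_space M \<and>
     prob_space.indep_vars M (\<lambda>_. borel) Z {1..m} \<and>
     (\<forall>j\<in>{1..m}. measure M {\<omega> \<in> space M. Z j \<omega> = 1} = f j \<and>
                  measure M {\<omega> \<in> space M. Z j \<omega> = 0} = 1 - f j)"

text \<open>The inserted \<open>0\<close> is \<open>t\<^sub>0\<close>; in particular the empty portfolio has value \<open>0\<close>.\<close>

definition portfolio_value ::
  "'w measure \<Rightarrow> (nat \<Rightarrow> 'w \<Rightarrow> real) \<Rightarrow> (nat \<Rightarrow> real) \<Rightarrow> nat set \<Rightarrow> real" where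
  "portfolio_value M Z t X = (\<integral>\<omega>. Max (insert 0 ((\<lambda>j. t j * Z j \<omega>) ` X)) \<partial>M)"

definition feasible_portfolio :: "nat \<Rightarrow> (nat \<Rightarrow> nat) \<Rightarrow> nat \<Rightarrow> nat set \<Rightarrow> bool" where
  "feasible_portfolio m g H X \<longleftrightarrow> X \<subseteq> {1..m} \<and> (\<Sum>j\<in>X. g j) \<le> H"

definition optimal_portfolio ::
  "'w measure \<Rightarrow> (nat \<Rightarrow> 'w \<Rightarrow> real) \<Rightarrow> nat \<Rightarrow> (nat \<Rightarrow> real) \<Rightarrow> (nat \<Rightarrow> nat) \<Rightarrow> nat \<Rightarrow>
     nat set \<Rightarrow> bool" where
  "optimal_portfolio M Z m t g H X \<longleftrightarrow>
     feasible_portfolio m g H X \<and>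
     (\<forall>Y. feasible_portfolio m g H Y \<longrightarrow> portfolio_value M Z t Y \<le> portfolio_value M Z t X)"


section \<open>A random access machine with unit-cost operations\<close>

text \<open>
  The writable random access memory consists of the array \<open>school\<close>, which stores at position
  \<open>j\<close> the original number of the school that is \<open>j\<close>-th in the new indexing, and the lookup table
  \<open>V\<close>; \<open>steps\<close> is the running time so far.  Programs live in the state monad over this record,
  so the memory is used single-threadedly and an array update can be performed in place.

  Every arithmetic operation, comparison, list cell construction and every read or write of a
  single array entry (including the input arrays \<open>t\<close>, \<open>f\<close>, \<open>g\<close>) is charged one step.  Loop
  control and recursive calls are charged as well.  The embeddings of naturals into
  integers and of reals into extended reals do not change the number and are free.
\<close>

record machine =
  school :: "nat \<Rightarrow> nat"
  V :: "nat \<Rightarrow> int \<Rightarrow> ereal"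
  steps :: nat

type_synonym 'a prog = "(machine, 'a) state"

definition charge :: "nat \<Rightarrow> unit prog" where
  "charge k = State (\<lambda>s. ((), s\<lparr>steps := steps s + k\<rparr>))"

text \<open>The argument of \<open>unit_op\<close> is a constant, a variable or a single elementary operation.\<close>

definition unit_op :: "'a \<Rightarrow> 'a prog" where
  "unit_op x = do { charge 1; State_Monad.return x }"

definition read_school :: "nat \<Rightarrow> nat prog" where
  "read_school j = do { charge 1; State (\<lambda>s. (school s j, s)) }"

definition write_school :: "nat \<Rightarrow> nat \<Rightarrow> unit prog" where
  "write_school j i = do { charge 1; State (\<lambda>s. ((), s\<lparr>school := (school s)(j := i)\<rparr>)) }"

definition read_V :: "nat \<Rightarrow> int \<Rightarrow> ereal prog" where
  "read_V j h = do { charge 1; State (\<lambda>s. (V s j h, s)) }"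

definition write_V :: "nat \<Rightarrow> int \<Rightarrow> ereal \<Rightarrow> unit prog" where
  "write_V j h x =
     do { charge 1; State (\<lambda>s. ((), s\<lparr>V := (V s)(j := (V s j)(h := x))\<rparr>)) }"

text \<open>
  The list is the sequence of values of the loop counter.  Each iteration is charged for the
  update and the test of the counter.
\<close>

primrec for_each :: "'a list \<Rightarrow> ('a \<Rightarrow> unit prog) \<Rightarrow> unit prog" where
  "for_each [] body = charge 1"
| "for_each (x # xs) body = do { charge 2; body x; for_each xs body }"


section \<open>The algorithm\<close>

subsection \<open>Step 1: indexing by nondecreasing \<open>t\<close>\<close>

fun merge_by :: "(nat \<Rightarrow> real) \<Rightarrow> nat list \<Rightarrow> nat list \<Rightarrow> nat list prog" where
  "merge_by t [] ys = unit_op ys"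
| "merge_by t (x # xs) [] = unit_op (x # xs)"
| "merge_by t (x # xs) (y # ys) = do {
     charge 2;
     a \<leftarrow> unit_op (t x);
     b \<leftarrow> unit_op (t y);
     le \<leftarrow> unit_op (a \<le> b);
     if le
     then do { zs \<leftarrow> merge_by t xs (y # ys); unit_op (x # zs) }
     else do { zs \<leftarrow> merge_by t (x # xs) ys; unit_op (y # zs) } }"

text \<open>
  Merge sort of the \<open>n\<close> schools \<open>i, \<dots>, i + n - 1\<close>.  The charge of \<open>6\<close> covers the two tests on
  \<open>n\<close>, the computation of \<open>n div 2\<close> and of the remaining two arguments of the recursive calls,
  and the call itself; it is not split up into \<open>unit_op\<close>s because the termination proof has
  to see these arguments.
\<close>

fun merge_sort_by :: "(nat \<Rightarrow> real) \<Rightarrow> nat \<Rightarrow> nat \<Rightarrow> nat list prog" where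
  "merge_sort_by t i n =
     (if n = 0 then do { charge 1; unit_op [] }
      else if n = 1 then do { charge 2; unit_op [i] }
      else do {
        charge 6;
        xs \<leftarrow> merge_sort_by t i (n div 2);
        ys \<leftarrow> merge_sort_by t (i + n div 2) (n - n div 2);
        merge_by t xs ys })"

declare merge_sort_by.simps [simp del]

primrec store_indexing :: "nat \<Rightarrow> nat list \<Rightarrow> unit prog" where
  "store_indexing j [] = charge 1"
| "store_indexing j (i # xs) = do { charge 2; write_school j i; store_indexing (j + 1) xs }"

definition index_schools :: "nat \<Rightarrow> (nat \<Rightarrow> real) \<Rightarrow> unit prog" where
  "index_schools m t = do { order \<leftarrow> merge_sort_by t 1 m; store_indexing 1 order }"

text \<open>
  What step 1 has to achieve; the indexing is not unique if \<open>t\<close> has repeated entries.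
\<close>

definition nondecreasing_indexing :: "nat \<Rightarrow> (nat \<Rightarrow> real) \<Rightarrow> (nat \<Rightarrow> nat) \<Rightarrow> bool" where
  "nondecreasing_indexing m t \<sigma> \<longleftrightarrow>
     bij_betw \<sigma> {1..m} {1..m} \<and> mono_on {1..m} (\<lambda>j. t (\<sigma> j))"

subsection \<open>Step 2: filling the table\<close>

text \<open>\<open>V[j,h]\<close>, with the convention \<open>V[j,h] = -\<infinity>\<close> for \<open>h < 0\<close>\<close>

definition lookup :: "nat \<Rightarrow> int \<Rightarrow> ereal prog" where
  "lookup j h = do {
     neg \<leftarrow> unit_op (h < 0);
     if neg then unit_op (- \<infinity>) else read_V j h }"

text \<open>
  Multiplication with the convention \<open>-\<infinity> \<cdot> 0 = -\<infinity>\<close>.  The product of type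
  \<^typ>\<open>ereal\<close> has \<open>-\<infinity> \<cdot> 0 = 0\<close> instead.
\<close>

definition ext_times :: "real \<Rightarrow> ereal \<Rightarrow> ereal prog" where
  "ext_times c x = do {
     inf \<leftarrow> unit_op (x = - \<infinity>);
     if inf then unit_op (- \<infinity>) else unit_op (ereal c * x) }"

definition fill_entry ::
  "(nat \<Rightarrow> real) \<Rightarrow> (nat \<Rightarrow> real) \<Rightarrow> (nat \<Rightarrow> nat) \<Rightarrow> nat \<Rightarrow> int \<Rightarrow> unit prog" where
  "fill_entry t f g j h = do {
     i \<leftarrow> read_school j;
     ti \<leftarrow> unit_op (t i);
     fi \<leftarrow> unit_op (f i);
     gi \<leftarrow> unit_op (g i);
     j' \<leftarrow> unit_op (j - 1);
     a \<leftarrow> lookup j' h;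
     h' \<leftarrow> unit_op (h - int gi);
     b \<leftarrow> lookup j' h';
     c \<leftarrow> unit_op (1 - fi);
     cb \<leftarrow> ext_times c b;
     ft \<leftarrow> unit_op (fi * ti);
     d \<leftarrow> unit_op (cb + ereal ft);
     x \<leftarrow> unit_op (max a d);
     write_V j h x }"

definition fill_table ::
  "nat \<Rightarrow> (nat \<Rightarrow> real) \<Rightarrow> (nat \<Rightarrow> real) \<Rightarrow> (nat \<Rightarrow> nat) \<Rightarrow> nat \<Rightarrow> unit prog" where
  "fill_table m t f g H = do {
     for_each [0..int H] (\<lambda>h. write_V 0 h 0);
     for_each [1..<m + 1] (\<lambda>j. do {
       write_V j 0 0;
       for_each [1..int H] (\<lambda>h. fill_entry t f g j h) }) }"

subsection \<open>Steps 3 and 4: recovering a portfolio\<close>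

text \<open>
  \<open>select g j h X\<close> performs the iterations \<open>j, j - 1, \<dots>, 1\<close> and returns the final \<open>X\<close>.  The
  portfolio is a list of original school numbers; no school is inserted twice.
\<close>

primrec select :: "(nat \<Rightarrow> nat) \<Rightarrow> nat \<Rightarrow> int \<Rightarrow> nat list \<Rightarrow> nat list prog" where
  "select g 0 h X = unit_op X"
| "select g (Suc j) h X = do {
     charge 2;
     a \<leftarrow> lookup j h;
     b \<leftarrow> lookup (Suc j) h;
     improves \<leftarrow> unit_op (a < b);
     if improves
     then do {
       i \<leftarrow> read_school (Suc j);
       gi \<leftarrow> unit_op (g i);
       X' \<leftarrow> unit_op (i # X);
       h' \<leftarrow> unit_op (h - int gi);
       select g j h' X' }
     else select g j h X }"

definition dynamic_program ::
  "nat \<Rightarrow> (nat \<Rightarrow> real) \<Rightarrow> (nat \<Rightarrow> real) \<Rightarrow> (nat \<Rightarrow> nat) \<Rightarrow> nat \<Rightarrow> nat list prog" where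
  "dynamic_program m t f g H = do { fill_table m t f g H; select g m (int H) [] }"

definition algorithm_D ::
  "nat \<Rightarrow> (nat \<Rightarrow> real) \<Rightarrow> (nat \<Rightarrow> real) \<Rightarrow> (nat \<Rightarrow> nat) \<Rightarrow> nat \<Rightarrow> nat list prog" where
  "algorithm_D m t f g H = do { index_schools m t; dynamic_program m t f g H }"

definition result :: "'a prog \<Rightarrow> machine \<Rightarrow> 'a" where
  "result p s = fst (run_state p s)"

definition running_time :: "'a prog \<Rightarrow> machine \<Rightarrow> nat" where
  "running_time p s = steps (snd (run_state p (s\<lparr>steps := 0\<rparr>)))"

end

theory Submission
  imports Defs
begin

text \<open>
  Index the schools by nondecreasing \<open>t\<close>.  If school \<open>j\<close> is added to a portfolio \<open>X\<close> of schools
  with smaller indices, then with probability \<open>f j\<close> it admits and is the best offer, and otherwise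
  the rest of the portfolio decides; by independence
  \<open>v(X \<union> {j}) = (1 - f j) v(X) + f j t j\<close>.  The right-hand side is nondecreasing in \<open>v(X)\<close>, so
  Bellman's principle applies: the table contains the optimal values of the subproblems with schools
  \<open>1, \<dots>, j\<close> and budget \<open>h\<close>, and backtracking recovers a portfolio attaining \<open>V[m, H]\<close>.
  Every table entry costs a constant number of steps and merge sort contributes \<open>m log m\<close>.
\<close>

subsection \<open>Running programs of the machine\<close>

lemma run_charge [simp]: "run_state (charge k) s = ((), s\<lparr>steps := steps s + k\<rparr>)"
  by (simp add: charge_def)

lemma run_unit_op [simp]: "run_state (unit_op x) s = (x, s\<lparr>steps := steps s + 1\<rparr>)"
  by (simp add: unit_op_def)

lemma run_read_school [simp]:
  "run_state (read_school j) s = (school s j, s\<lparr>steps := steps s + 1\<rparr>)"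
  by (simp add: read_school_def)

lemma run_write_school [simp]:
  "run_state (write_school j i) s =
     ((), s\<lparr>school := (school s)(j := i), steps := steps s + 1\<rparr>)"
  by (simp add: write_school_def)

lemma run_read_V [simp]: "run_state (read_V j h) s = (V s j h, s\<lparr>steps := steps s + 1\<rparr>)"
  by (simp add: read_V_def)

lemma run_write_V [simp]:
  "run_state (write_V j h x) s =
     ((), s\<lparr>V := (V s)(j := (V s j)(h := x)), steps := steps s + 1\<rparr>)"
  by (simp add: write_V_def)

text \<open>For loops whose bodies only transform the table, at a fixed cost \<open>c\<close>. The
  indexing is pinned to \<open>\<sigma>\<close> because bodies read it, so \<open>F\<close> may
  depend on it. An iteration adds the loop charge 2, leaving the loop costs 1.\<close>

lemma run_for_each:
  assumes "\<And>x s. x \<in> set xs \<Longrightarrow> school s = \<sigma> \<Longrightarrow>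
             run_state (body x) s = ((), s\<lparr>V := F x (V s), steps := steps s + c\<rparr>)"
    and "school s = \<sigma>"
  shows "run_state (for_each xs body) s =
           ((), s\<lparr>V := fold F xs (V s), steps := steps s + ((c + 2) * length xs + 1)\<rparr>)"
  using assms
proof (induction xs arbitrary: s)
  case (Cons x xs)
  then show ?case by (simp add: algebra_simps)
qed simp

subsection \<open>Merge sort\<close>

text \<open>Each emitted element costs 6 steps: the charge of 2, two keys, one comparison and one
  list cell; the base case costs 1.\<close>

lemma run_merge_by:
  "\<exists>zs k. run_state (merge_by t xs ys) s = (zs, s\<lparr>steps := steps s + k\<rparr>) \<and>
     k \<le> 6 * (length xs + length ys) + 1 \<and> mset zs = mset xs + mset ys \<and>
     (sorted (map t xs) \<and> sorted (map t ys) \<longrightarrow> sorted (map t zs))"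
proof (induction t xs ys arbitrary: s rule: merge_by.induct)
  case (3 t x xs y ys)
  let ?s = "s\<lparr>steps := steps s + 5\<rparr>"
  show ?case
  proof (cases "t x \<le> t y")
    case True
    obtain zs k where *: "run_state (merge_by t xs (y # ys)) ?s = (zs, ?s\<lparr>steps := steps ?s + k\<rparr>)"
      "k \<le> 6 * (length xs + length (y # ys)) + 1" "mset zs = mset xs + mset (y # ys)"
      "sorted (map t xs) \<and> sorted (map t (y # ys)) \<longrightarrow> sorted (map t zs)"
      using "3.IH"(1)[of True ?s] True by blast
    \<comment> \<open>Prepending \<open>x\<close> keeps the list sorted if \<open>t x\<close> is
      below every remaining key, so the elements of \<open>zs\<close> have to be known.\<close>
    have "set zs = set xs \<union> set (y # ys)"
      using *(3) by (metis set_mset_mset set_mset_union)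
    moreover have "run_state (merge_by t (x # xs) (y # ys)) s =
        (x # zs, s\<lparr>steps := steps s + (k + 6)\<rparr>)"
      using True *(1) by (simp add: eval_nat_numeral)
    ultimately show ?thesis
      using True *(2-4) by (intro exI[of _ "x # zs"] exI[of _ "k + 6"]) auto
  next
    case False
    obtain zs k where *: "run_state (merge_by t (x # xs) ys) ?s = (zs, ?s\<lparr>steps := steps ?s + k\<rparr>)"
      "k \<le> 6 * (length (x # xs) + length ys) + 1" "mset zs = mset (x # xs) + mset ys"
      "sorted (map t (x # xs)) \<and> sorted (map t ys) \<longrightarrow> sorted (map t zs)"
      using "3.IH"(2)[of False ?s] False by blast
    have "set zs = set (x # xs) \<union> set ys"
      using *(3) by (metis set_mset_mset set_mset_union)
    moreover have "run_state (merge_by t (x # xs) (y # ys)) s =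
        (y # zs, s\<lparr>steps := steps s + (k + 6)\<rparr>)"
      using False *(1) by (simp add: eval_nat_numeral)
    ultimately show ?thesis
      using False *(2-4) by (intro exI[of _ "y # zs"] exI[of _ "k + 6"]) auto
  qed
qed (auto intro: exI[of _ 1])

text \<open>The hypothesis is a \<le> n / sqrt 2 in squared form, which stays within the naturals;
  taking logarithms gives 1 + 2 log a \<le> 2 log n.\<close>

lemma log_le_log_diff_half:
  fixes a n :: nat
  assumes "0 < a" and "2 * a\<^sup>2 \<le> n\<^sup>2"
  shows "log 2 (real a) \<le> log 2 (real n) - 1 / 2"
proof -
  have n: "0 < n" using assms by (cases n) auto
  have "real (2 * a\<^sup>2) \<le> real (n\<^sup>2)" using assms(2) of_nat_le_iff by blast
  then have "log 2 (2 * (real a)\<^sup>2) \<le> log 2 ((real n)\<^sup>2)"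
    using assms n by simp
  then show ?thesis
    using assms n by (simp add: log_mult log_nat_power)
qed

text \<open>Both halves have at most \<open>n / \<surd>2\<close> elements, so that a level of the recursion decreases
  \<open>14 n log n\<close> by \<open>7 n\<close>, which pays for the merge.\<close>

lemma run_merge_sort_by:
  "\<exists>zs k. run_state (merge_sort_by t i n) s = (zs, s\<lparr>steps := steps s + k\<rparr>) \<and>
     real k \<le> 14 * (real n * log 2 (real n)) + 10 * real n + 2 \<and>
     (0 < n \<longrightarrow> real k \<le> 14 * (real n * log 2 (real n)) + 10 * real n - 7) \<and>
     mset zs = mset [i..<i + n] \<and> sorted (map t zs)"
proof (induction n arbitrary: i s rule: less_induct)
  case (less n)
  consider "n = 0" | "n = 1" | "2 \<le> n" by linarith
  then show ?case
  proof cases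
    \<comment> \<open>The cost 2 fits only the bound with \<open>+ 2\<close>. For n = 1 the cost 3 =
      10 - 7 attains the stronger bound, which the recursion uses.\<close>
    case 1
    then show ?thesis
      by (intro exI[of _ "[]"] exI[of _ 2]) (simp add: merge_sort_by.simps eval_nat_numeral)
  next
    case 2
    then show ?thesis
      by (intro exI[of _ "[i]"] exI[of _ 3]) (simp add: merge_sort_by.simps eval_nat_numeral)
  next
    case 3
    define p q where "p = n div 2" and "q = n - n div 2"
    have pq: "p + q = n" "0 < p" "0 < q" "p < n" "q < n" "p \<le> q" "2 * q \<le> n + 1"
      using 3 by (auto simp: p_def q_def)
    \<comment> \<open>The larger half is at most (n + 1) / 2, and (n + 1)^2 \<le> n^2 + 3 n \<le> 2
      n^2 for n \<ge> 3. For n = 2 this fails, but there q = 1.\<close>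
    have "4 * q\<^sup>2 \<le> (n + 1)\<^sup>2"
      using power_mono[OF pq(7), of 2] by (simp add: power_mult_distrib)
    moreover have "(n + 1)\<^sup>2 \<le> 2 * n\<^sup>2" if "3 \<le> n"
    proof -
      have "3 * n \<le> n * n" using that by simp
      then show ?thesis using that unfolding power2_eq_square distrib_left distrib_right by linarith
    qed
    ultimately have q2: "2 * q\<^sup>2 \<le> n\<^sup>2"
      using pq(7) 3 by (cases "n = 2") (auto simp: power2_eq_square)
    then have p2: "2 * p\<^sup>2 \<le> n\<^sup>2"
      using power_mono[OF pq(6), of 2] by linarith
    define L where "L = log 2 (real n)"
    have n: "real n = real p + real q" using pq(1) by linarith
    have "real p * log 2 (real p) \<le> real p * (L - 1/2)" "real q * log 2 (real q) \<le> real q * (L - 1/2)"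
      using log_le_log_diff_half[OF pq(2) p2] log_le_log_diff_half[OF pq(3) q2]
      unfolding L_def by (auto intro: mult_left_mono)
    then have log: "real p * log 2 (real p) + real q * log 2 (real q) \<le> real n * L - real n / 2"
      unfolding n by (simp add: algebra_simps add_divide_distrib)
    let ?s = "s\<lparr>steps := steps s + 6\<rparr>"
    obtain xs a where xs: "run_state (merge_sort_by t i p) ?s = (xs, ?s\<lparr>steps := steps ?s + a\<rparr>)"
      "real a \<le> 14 * (real p * log 2 (real p)) + 10 * real p - 7"
      "mset xs = mset [i..<i + p]" "sorted (map t xs)"
      using less.IH[OF pq(4), of i ?s] pq(2) by blast
    let ?s' = "?s\<lparr>steps := steps ?s + a\<rparr>"
    obtain ys b where ys: "run_state (merge_sort_by t (i + p) q) ?s' = (ys, ?s'\<lparr>steps := steps ?s' + b\<rparr>)"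
      "real b \<le> 14 * (real q * log 2 (real q)) + 10 * real q - 7"
      "mset ys = mset [i + p..<i + p + q]" "sorted (map t ys)"
      using less.IH[OF pq(5), of "i + p" ?s'] pq(3) by blast
    let ?s'' = "?s'\<lparr>steps := steps ?s' + b\<rparr>"
    obtain zs c where zs: "run_state (merge_by t xs ys) ?s'' = (zs, ?s''\<lparr>steps := steps ?s'' + c\<rparr>)"
      "c \<le> 6 * (length xs + length ys) + 1" "mset zs = mset xs + mset ys" "sorted (map t zs)"
      using run_merge_by[of t xs ys ?s''] xs(4) ys(4) by blast
    have len: "length xs + length ys = n"
      using arg_cong[OF xs(3), of size] arg_cong[OF ys(3), of size] pq(1) by simp
    have "mset zs = mset [i..<i + n]"
      using zs(3) xs(3) ys(3) pq(1) upt_add_eq_append[of i "i + p" q]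
      by (metis add.assoc le_add1 mset_append)
    moreover have "run_state (merge_sort_by t i n) s = (zs, s\<lparr>steps := steps s + (6 + a + b + c)\<rparr>)"
      using 3 xs(1) ys(1) zs(1) unfolding p_def q_def
      by (subst merge_sort_by.simps) (simp add: add.assoc)
    moreover have "real c \<le> 6 * real n + 1"
      using zs(2) unfolding len by linarith
    \<comment> \<open>The halves contribute - 14, the call + 6 and the merge + 1, which restores -
      7; the remaining 6 n of the merge is covered by the 7 n saved in \<open>log\<close>.\<close>
    with log xs(2) ys(2) have "real (6 + a + b + c) \<le> 14 * (real n * L) + 10 * real n - 7"
      unfolding n distrib_right distrib_left add_divide_distrib of_nat_add of_nat_numeral by linarith
    ultimately show ?thesis
      using zs(4) unfolding L_def by (intro exI[of _ zs] exI[of _ "6 + a + b + c"]) auto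
  qed
qed

section \<open>The sorted list as an indexing of the schools\<close>

definition overwrite :: "nat \<Rightarrow> 'a list \<Rightarrow> (nat \<Rightarrow> 'a) \<Rightarrow> nat \<Rightarrow> 'a" where
  "overwrite j xs a k = (if j \<le> k \<and> k < j + length xs then xs ! (k - j) else a k)"

lemma overwrite_Nil [simp]: "overwrite j [] a = a"
  by (rule ext) (auto simp: overwrite_def)

lemma overwrite_Cons: "overwrite j (x # xs) a = overwrite (Suc j) xs (a(j := x))"
  by (auto simp: overwrite_def fun_eq_iff nth_Cons')

lemma run_store_indexing:
  "run_state (store_indexing j xs) s =
     ((), s\<lparr>school := overwrite j xs (school s), steps := steps s + (3 * length xs + 1)\<rparr>)"
  by (induction xs arbitrary: j s) (simp_all add: overwrite_Cons)

text \<open>The sorted list enumerates the schools without repetition, so writing it to positions 1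
  to m yields a bijection, and sortedness of the keys becomes monotonicity. Storing adds 3 m + 1
  steps.\<close>

lemma run_index_schools:
  "\<exists>\<sigma> k. run_state (index_schools m t) s = ((), s\<lparr>school := \<sigma>, steps := steps s + k\<rparr>) \<and>
     real k \<le> 14 * (real m * log 2 (real m)) + 13 * real m + 3 \<and>
     nondecreasing_indexing m t \<sigma>"
proof -
  obtain xs k where xs: "run_state (merge_sort_by t 1 m) s = (xs, s\<lparr>steps := steps s + k\<rparr>)"
    "real k \<le> 14 * (real m * log 2 (real m)) + 10 * real m + 2"
    "mset xs = mset [1..<1 + m]" "sorted (map t xs)"
    using run_merge_sort_by[of t 1 m s] by blast
  define \<sigma> where "\<sigma> = overwrite 1 xs (school s)"
  have len: "length xs = m" using arg_cong[OF xs(3), of size] by simp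
  have set_xs: "set xs = {1..m}" using arg_cong[OF xs(3), of set_mset] by auto
  have "distinct xs" using xs(3) by (metis distinct_upt mset_eq_imp_distinct_iff)
  then have "bij_betw ((!) xs) {..<m} {1..m}"
    using bij_betw_nth[of xs "{..<m}" "{1..m}"] len set_xs by simp
  moreover have "bij_betw (\<lambda>k. k - 1) {1..m} {..<m}"
    by (rule bij_betw_byWitness[where f' = Suc]) auto
  ultimately have "bij_betw ((!) xs \<circ> (\<lambda>k. k - 1)) {1..m} {1..m}"
    by (rule bij_betw_trans[rotated])
  then have "bij_betw \<sigma> {1..m} {1..m}"
    by (rule bij_betw_cong[THEN iffD1, rotated]) (auto simp: \<sigma>_def overwrite_def len)
  moreover have "mono_on {1..m} (\<lambda>j. t (\<sigma> j))"
  proof (rule mono_onI)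
    fix a b assume "a \<in> {1..m}" "b \<in> {1..m}" "a \<le> b"
    then show "t (\<sigma> a) \<le> t (\<sigma> b)"
      using sorted_nth_mono[OF xs(4), of "a - 1" "b - 1"] by (auto simp: \<sigma>_def overwrite_def len)
  qed
  moreover have "run_state (index_schools m t) s =
      ((), s\<lparr>school := \<sigma>, steps := steps s + (k + (3 * m + 1))\<rparr>)"
    by (simp add: index_schools_def xs(1)[unfolded One_nat_def] run_store_indexing \<sigma>_def len add.assoc)
  ultimately show ?thesis
    using xs(2) by (intro exI[of _ \<sigma>] exI[of _ "k + (3 * m + 1)"]) (auto simp: nondecreasing_indexing_def)
qed

subsection \<open>The table\<close>

definition table_lookup :: "(nat \<Rightarrow> int \<Rightarrow> ereal) \<Rightarrow> nat \<Rightarrow> int \<Rightarrow> ereal" where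
  "table_lookup T j h = (if h < 0 then - \<infinity> else T j h)"

text \<open>The case distinction matters at f j = 1, where the extended real product of 0 and -
  \<infinity> would be 0.\<close>

definition table_entry ::
  "(nat \<Rightarrow> real) \<Rightarrow> (nat \<Rightarrow> real) \<Rightarrow> (nat \<Rightarrow> nat) \<Rightarrow> (nat \<Rightarrow> int \<Rightarrow> ereal) \<Rightarrow> nat \<Rightarrow> int \<Rightarrow> ereal" where
  "table_entry t f g T j h =
     max (table_lookup T (j - 1) h)
       ((let b = table_lookup T (j - 1) (h - int (g j)) in
           if b = - \<infinity> then - \<infinity> else ereal (1 - f j) * b) + ereal (f j * t j))"

lemma run_lookup [simp]:
  "run_state (lookup j h) s = (table_lookup (V s) j h, s\<lparr>steps := steps s + 2\<rparr>)"
  by (simp add: lookup_def table_lookup_def)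

lemma run_ext_times [simp]:
  "run_state (ext_times c x) s =
     (if x = - \<infinity> then - \<infinity> else ereal c * x, s\<lparr>steps := steps s + 2\<rparr>)"
  by (simp add: ext_times_def)

text \<open>Composing the data with \<open>\<sigma>\<close> lets all later arguments speak of new
  indices only. Two lookups and the product take 6 steps, the other 11 operations one each.\<close>

lemma run_fill_entry:
  assumes "school s = \<sigma>"
  shows "run_state (fill_entry t f g j h) s =
     ((), s\<lparr>V := (V s)(j := (V s j)(h := table_entry (t \<circ> \<sigma>) (f \<circ> \<sigma>) (g \<circ> \<sigma>) (V s) j h)),
            steps := steps s + 17\<rparr>)"
  by (simp add: fill_entry_def table_entry_def Let_def assms)

definition fill_row ::
  "(nat \<Rightarrow> real) \<Rightarrow> (nat \<Rightarrow> real) \<Rightarrow> (nat \<Rightarrow> nat) \<Rightarrow> nat \<Rightarrow> nat \<Rightarrow>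
     (nat \<Rightarrow> int \<Rightarrow> ereal) \<Rightarrow> (nat \<Rightarrow> int \<Rightarrow> ereal)" where
  "fill_row t f g H j T =
     fold (\<lambda>h T. T(j := (T j)(h := table_entry t f g T j h))) [1..int H] (T(j := (T j)(0 := 0)))"

text \<open>With the loop charge an entry costs 19. A row adds 1 for leaving its loop, 1 for column
  0 and 2 for the outer loop; row 0 costs 3 per cell.\<close>

lemma run_fill_table:
  fixes s :: machine and H :: nat
  defines "\<sigma> \<equiv> school s"
  shows "run_state (fill_table m t f g H) s =
    ((), s\<lparr>V := fold (fill_row (t \<circ> \<sigma>) (f \<circ> \<sigma>) (g \<circ> \<sigma>) H) [1..<m + 1]
                  (fold (\<lambda>h T. T(0 := (T 0)(h := 0))) [0..int H] (V s)),
           steps := steps s + (3 * (H + 1) + 1 + ((19 * H + 4) * m + 1))\<rparr>)"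
proof -
  have row: "run_state (for_each [1..int H] (\<lambda>h. fill_entry t f g j h)) s' =
      ((), s'\<lparr>V := fold (\<lambda>h T. T(j := (T j)(h := table_entry (t \<circ> \<sigma>) (f \<circ> \<sigma>) (g \<circ> \<sigma>) T j h)))
                 [1..int H] (V s'),
             steps := steps s' + (19 * H + 1)\<rparr>)" if "school s' = \<sigma>" for j s'
    by (subst run_for_each[OF run_fill_entry that]) auto
  have rows: "run_state (for_each [1..<m + 1] (\<lambda>j. do {
       write_V j 0 0;
       for_each [1..int H] (\<lambda>h. fill_entry t f g j h) })) s' =
      ((), s'\<lparr>V := fold (fill_row (t \<circ> \<sigma>) (f \<circ> \<sigma>) (g \<circ> \<sigma>) H) [1..<m + 1] (V s'),
             steps := steps s' + ((19 * H + 4) * m + 1)\<rparr>)" if "school s' = \<sigma>" for s'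
    by (subst run_for_each[where c = "19 * H + 2" and \<sigma> = \<sigma> and
          F = "fill_row (t \<circ> \<sigma>) (f \<circ> \<sigma>) (g \<circ> \<sigma>) H"])
       (auto simp: row fill_row_def that add_mult_distrib simp del: upt_Suc)
  have "run_state (for_each [0..int H] (\<lambda>h. write_V 0 h 0)) s =
      ((), s\<lparr>V := fold (\<lambda>h T. T(0 := (T 0)(h := 0))) [0..int H] (V s),
             steps := steps s + (3 * (H + 1) + 1)\<rparr>)"
    by (subst run_for_each[where c = 1 and \<sigma> = \<sigma> and F = "\<lambda>h T. T(0 := (T 0)(h := 0))"])
       (auto simp: \<sigma>_def)
  then show ?thesis
    using rows[of "s\<lparr>V := fold (\<lambda>h T. T(0 := (T 0)(h := 0))) [0..int H] (V s),
             steps := steps s + (3 * (H + 1) + 1)\<rparr>"]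
    unfolding fill_table_def by (simp add: \<sigma>_def add.assoc del: upt_Suc)
qed

text \<open>The hypothesis says that \<open>e\<close> does not look at row \<open>j\<close>, so
  successive writes to this row do not influence each other and amount to one simultaneous
  update.\<close>

lemma fold_update_entries:
  assumes "\<And>T r. e (T(j := r)) = e T"
  shows "fold (\<lambda>h T. T(j := (T j)(h := e T h))) hs T =
           T(j := (\<lambda>h. if h \<in> set hs then e T h else T j h))"
proof (induction hs arbitrary: T)
  case (Cons h hs)
  show ?case
    by (simp only: fold.simps comp_apply Cons assms fun_upd_upd fun_upd_same) (auto simp: fun_eq_iff)
qed (simp add: fun_eq_iff)

lemma fill_row_eq:
  assumes "0 < j"
  shows "fill_row t f g H j T =
    T(j := (\<lambda>h. if h \<in> {1..int H} then table_entry t f g T j h else if h = 0 then 0 else T j h))"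
proof -
  have *: "table_entry t f g (T(j := r)) j = table_entry t f g T j" for T r
  proof -
    \<comment> \<open>Row \<open>j\<close> is computed from row \<open>j - 1\<close>, which on the
      naturals is a different row because \<open>j\<close> is positive.\<close>
    have "j - 1 \<noteq> j" using assms by simp
    then show ?thesis by (simp add: table_entry_def table_lookup_def fun_eq_iff)
  qed
  show ?thesis
    unfolding fill_row_def by (subst fold_update_entries) (auto simp: * fun_eq_iff)
qed

text \<open>Bellman's recursion over the reals: skipping an unaffordable school replaces the value -
  \<infinity>.\<close>

primrec opt_value ::
  "(nat \<Rightarrow> real) \<Rightarrow> (nat \<Rightarrow> real) \<Rightarrow> (nat \<Rightarrow> nat) \<Rightarrow> nat \<Rightarrow> int \<Rightarrow> real" where
  "opt_value t f g 0 h = 0"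
| "opt_value t f g (Suc j) h =
     (if int (g (Suc j)) \<le> h
      then max (opt_value t f g j h)
             ((1 - f (Suc j)) * opt_value t f g j (h - int (g (Suc j))) + f (Suc j) * t (Suc j))
      else opt_value t f g j h)"

lemma opt_value_mono_index: "opt_value t f g j h \<le> opt_value t f g (Suc j) h"
  by simp

text \<open>Positive costs exclude every school at budget 0, in agreement with the zeros written
  into column 0.\<close>

lemma opt_value_budget_0: "(\<And>i. i \<in> {1..j} \<Longrightarrow> 0 < g i) \<Longrightarrow> opt_value t f g j 0 = 0"
proof (induction j)
  case (Suc j)
  then have "opt_value t f g j 0 = 0" "0 < g (Suc j)" by auto
  then show ?case by simp
qed simp

definition correct_table ::
  "nat \<Rightarrow> (nat \<Rightarrow> real) \<Rightarrow> (nat \<Rightarrow> real) \<Rightarrow> (nat \<Rightarrow> nat) \<Rightarrow> nat \<Rightarrow> (nat \<Rightarrow> int \<Rightarrow> ereal) \<Rightarrow> bool" where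
  "correct_table m t f g H T \<longleftrightarrow>
     (\<forall>j\<le>m. \<forall>h\<in>{0..int H}. T j h = ereal (opt_value t f g j h))"

lemma correct_table_fold:
  assumes "\<And>i. i \<in> {1..m} \<Longrightarrow> 0 < g i"
  shows "correct_table m t f g H (fold (fill_row t f g H) [1..<m + 1]
           (fold (\<lambda>h T. T(0 := (T 0)(h := 0))) [0..int H] T))"
  using assms
proof (induction m)
  case 0
  show ?case
    by (subst fold_update_entries) (auto simp: correct_table_def)
next
  case (Suc m)
  define T' where "T' = fold (fill_row t f g H) [1..<m + 1]
           (fold (\<lambda>h T. T(0 := (T 0)(h := 0))) [0..int H] T)"
  have "correct_table m t f g H T'"
    unfolding T'_def by (rule Suc.IH) (use Suc.prems in auto)
  then have IH: "T' j h = ereal (opt_value t f g j h)" if "j \<le> m" "h \<in> {0..int H}" for j h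
    using that by (simp add: correct_table_def)
  have fold_Suc: "fold (fill_row t f g H) [1..<Suc m + 1]
           (fold (\<lambda>h T. T(0 := (T 0)(h := 0))) [0..int H] T) = fill_row t f g H (Suc m) T'"
    by (simp add: T'_def)
  \<comment> \<open>If the school is too expensive, the second argument of the maximum is -
    \<infinity> and loses against the real value of the previous row; otherwise both reads hit
    entries covered by \<open>IH\<close>.\<close>
  have "table_entry t f g T' (Suc m) h = ereal (opt_value t f g (Suc m) h)"
    if "h \<in> {1..int H}" for h
    using that IH[of m h] IH[of m "h - int (g (Suc m))"]
    by (auto simp: table_entry_def table_lookup_def ereal_max)
  moreover have "opt_value t f g (Suc m) 0 = 0"
    using Suc.prems by (rule opt_value_budget_0)
  ultimately have "fill_row t f g H (Suc m) T' (Suc m) h = ereal (opt_value t f g (Suc m) h)"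
    if "h \<in> {0..int H}" for h
    using that by (cases "h = 0") (auto simp: fill_row_eq simp del: opt_value.simps(2))
  with IH show ?case
    unfolding fold_Suc
    by (auto simp: correct_table_def fill_row_eq le_Suc_eq simp del: opt_value.simps(2))
qed

subsection \<open>Recovering a portfolio\<close>

lemma run_select_Suc:
  "run_state (select g (Suc j) h X) s =
     (if table_lookup (V s) j h < table_lookup (V s) (Suc j) h
      then run_state (select g j (h - int (g (school s (Suc j)))) (school s (Suc j) # X))
             (s\<lparr>steps := steps s + 11\<rparr>)
      else run_state (select g j h X) (s\<lparr>steps := steps s + 7\<rparr>))"
  by (simp add: eval_nat_numeral)

text \<open>An iteration costs 7, or 11 if the school is taken. The bound holds for any table
  content, so it is kept apart from correctness.\<close>

lemma run_select:
  "\<exists>zs k. run_state (select g j h X) s = (zs, s\<lparr>steps := steps s + k\<rparr>) \<and> k \<le> 11 * j + 1"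
proof (induction j arbitrary: h X s)
  case (Suc j)
  show ?case
  proof (cases "table_lookup (V s) j h < table_lookup (V s) (Suc j) h")
    case True
    let ?s = "s\<lparr>steps := steps s + 11\<rparr>"
    let ?i = "school s (Suc j)"
    obtain zs k where "run_state (select g j (h - int (g ?i)) (?i # X)) ?s =
        (zs, ?s\<lparr>steps := steps ?s + k\<rparr>)" "k \<le> 11 * j + 1"
      using Suc.IH by blast
    with True show ?thesis
      by (intro exI[of _ zs] exI[of _ "k + 11"]) (simp add: run_select_Suc algebra_simps del: select.simps)
  next
    case False
    let ?s = "s\<lparr>steps := steps s + 7\<rparr>"
    obtain zs k where "run_state (select g j h X) ?s =
        (zs, ?s\<lparr>steps := steps ?s + k\<rparr>)" "k \<le> 11 * j + 1"
      using Suc.IH by blast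
    with False show ?thesis
      by (intro exI[of _ zs] exI[of _ "k + 7"]) (simp add: run_select_Suc algebra_simps del: select.simps)
  qed
qed (auto intro: exI[of _ 1])

text \<open>Backtracking with an abstract \<open>val\<close> that obeys the recursion for a new
  largest index. The schools still to be selected solve the subproblem with indices up to
  \<open>j\<close> and budget \<open>h\<close>; \<open>X\<close> collects earlier choices. The
  witness \<open>S\<close> consists of new indices, the output of original school numbers.\<close>

lemma select_correct:
  fixes val :: "nat set \<Rightarrow> real" and s :: machine
  defines "\<sigma> \<equiv> school s"
  assumes empty: "val {} = 0"
    and insert: "\<And>j S. j \<in> {1..m} \<Longrightarrow> S \<subseteq> {1..<j} \<Longrightarrow>
                   val (insert j S) = (1 - f j) * val S + f j * t j"
    and table: "correct_table m t f (\<lambda>i. g (\<sigma> i)) H (V s)"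
    and "j \<le> m" "h \<in> {0..int H}"
  shows "\<exists>S\<subseteq>{1..j}. set (fst (run_state (select g j h X) s)) = \<sigma> ` S \<union> set X \<and>
           int (\<Sum>i\<in>S. g (\<sigma> i)) \<le> h \<and> val S = opt_value t f (\<lambda>i. g (\<sigma> i)) j h"
  using assms(4-6) unfolding \<sigma>_def
proof (induction j arbitrary: h X s)
  case 0
  then show ?case by (auto simp: empty)
next
  case (Suc j)
  let ?g = "\<lambda>i. g (school s i)"
  have eqs: "table_lookup (V s) j h = ereal (opt_value t f ?g j h)"
     "table_lookup (V s) (Suc j) h = ereal (opt_value t f ?g (Suc j) h)"
    using Suc.prems by (auto simp: table_lookup_def correct_table_def simp del: opt_value.simps)
  show ?case
  proof (cases "opt_value t f ?g j h < opt_value t f ?g (Suc j) h")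
    case True
    \<comment> \<open>An unaffordable school would leave the value unchanged; a strict gain forces
      the affordable branch and the second argument of its maximum.\<close>
    then have le: "int (?g (Suc j)) \<le> h"
      and opt: "opt_value t f ?g (Suc j) h =
        (1 - f (Suc j)) * opt_value t f ?g j (h - int (?g (Suc j))) + f (Suc j) * t (Suc j)"
      by (auto split: if_splits)
    let ?i = "school s (Suc j)"
    obtain S where S: "S \<subseteq> {1..j}" "int (\<Sum>i\<in>S. ?g i) \<le> h - int (?g (Suc j))"
      "val S = opt_value t f ?g j (h - int (?g (Suc j)))"
      "set (fst (run_state (select g j (h - int (g ?i)) (?i # X)) (s\<lparr>steps := steps s + 11\<rparr>))) =
         school s ` S \<union> set (?i # X)"
      using Suc.IH[of "s\<lparr>steps := steps s + 11\<rparr>" "h - int (g ?i)" "?i # X"] Suc.prems le by auto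
    have fin: "finite S" "Suc j \<notin> S"
      using S(1) finite_subset by auto
    show ?thesis
    proof (intro exI[of _ "insert (Suc j) S"] conjI)
      show "val (insert (Suc j) S) = opt_value t f ?g (Suc j) h"
        using insert[of "Suc j" S] S(1,3) opt Suc.prems(2)
        by (simp add: atLeastLessThanSuc_atLeastAtMost)
      show "int (\<Sum>i\<in>insert (Suc j) S. g (school s i)) \<le> h"
        using S(2) fin by simp
    qed (use S True eqs in \<open>auto simp: run_select_Suc simp del: opt_value.simps select.simps\<close>)
  next
    case False
    then have "opt_value t f ?g (Suc j) h = opt_value t f ?g j h"
      using opt_value_mono_index[of t f ?g j h] by linarith
    moreover obtain S where "S \<subseteq> {1..j}" "int (\<Sum>i\<in>S. ?g i) \<le> h" "val S = opt_value t f ?g j h"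
      "set (fst (run_state (select g j h X) (s\<lparr>steps := steps s + 7\<rparr>))) = school s ` S \<union> set X"
      using Suc.IH[of "s\<lparr>steps := steps s + 7\<rparr>" h X] Suc.prems by auto
    ultimately show ?thesis
      using False eqs
      by (intro exI[of _ S]) (auto simp: run_select_Suc simp del: opt_value.simps select.simps)
  qed
qed

text \<open>Since 1 - f \<ge> 0, the value of a portfolio is nondecreasing in the value of its part
  below the largest index, so an optimal value for that part gives an upper bound.\<close>

lemma val_le_opt_value:
  fixes val :: "nat set \<Rightarrow> real"
  assumes empty: "val {} = 0"
    and insert: "\<And>j S. j \<in> {1..m} \<Longrightarrow> S \<subseteq> {1..<j} \<Longrightarrow>
                   val (insert j S) = (1 - f j) * val S + f j * t j"
    and f: "\<And>j. j \<in> {1..m} \<Longrightarrow> f j \<le> 1"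
    and "j \<le> m" "S \<subseteq> {1..j}" "int (\<Sum>i\<in>S. g i) \<le> h"
  shows "val S \<le> opt_value t f g j h"
  using assms(4-6)
proof (induction j arbitrary: S h)
  case 0
  then show ?case by (simp add: empty)
next
  case (Suc j)
  show ?case
  proof (cases "Suc j \<in> S")
    case True
    define S' where "S' = S - {Suc j}"
    have S': "S = insert (Suc j) S'" "S' \<subseteq> {1..j}" "Suc j \<notin> S'" "finite S'"
      using True Suc.prems(2) finite_subset[OF Suc.prems(2)] by (auto simp: S'_def le_Suc_eq)
    have le: "int (\<Sum>i\<in>S'. g i) \<le> h - int (g (Suc j))"
      using Suc.prems(3) S' by simp
    then have "val S' \<le> opt_value t f g j (h - int (g (Suc j)))"
      using Suc.IH Suc.prems S' by auto
    then have "(1 - f (Suc j)) * val S' \<le>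
        (1 - f (Suc j)) * opt_value t f g j (h - int (g (Suc j)))"
      using f[of "Suc j"] Suc.prems(1) by (intro mult_left_mono) auto
    moreover have "val S = (1 - f (Suc j)) * val S' + f (Suc j) * t (Suc j)"
      using insert[of "Suc j" S'] S' Suc.prems(1)
      by (simp add: atLeastLessThanSuc_atLeastAtMost)
    ultimately have "val S \<le> (1 - f (Suc j)) * opt_value t f g j (h - int (g (Suc j))) + f (Suc j) * t (Suc j)"
      by simp
    moreover have "int (g (Suc j)) \<le> h" using le by linarith
    ultimately show ?thesis by simp
  next
    case False
    then have "S \<subseteq> {1..j}" using Suc.prems(2) by (auto simp: subset_eq le_Suc_eq)
    then show ?thesis
      using Suc.IH[of S h] Suc.prems opt_value_mono_index[of t f g j h] by linarith
  qed
qed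

subsection \<open>Portfolio values\<close>

text \<open>Serves both for offers on the probability space and for functions of outcome vectors on
  a product space.\<close>

lemma borel_measurable_Max_insert_0:
  fixes F :: "'i \<Rightarrow> 'a \<Rightarrow> real"
  assumes "finite S" and "\<And>i. i \<in> S \<Longrightarrow> F i \<in> borel_measurable M"
  shows "(\<lambda>x. Max (insert 0 ((\<lambda>i. F i x) ` S))) \<in> borel_measurable M"
  using assms
proof (induction S)
  case (insert i S)
  have "(\<lambda>x. Max (insert 0 ((\<lambda>i. F i x) ` insert i S))) =
      (\<lambda>x. max (F i x) (Max (insert 0 ((\<lambda>i. F i x) ` S))))"
    using insert.hyps by (simp add: insert_commute[of 0] fun_eq_iff)
  then show ?case using insert by simp
qed simp

text \<open>The two prescribed probabilities add up to 1, so all other values together have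
  probability 0.\<close>

lemma indep_bernoulli_AE:
  assumes "indep_bernoulli m f M Z" and "j \<in> {1..m}"
  shows "AE \<omega> in M. Z j \<omega> = 0 \<or> Z j \<omega> = 1"
proof -
  interpret prob_space M using assms by (simp add: indep_bernoulli_def)
  have [measurable]: "Z j \<in> borel_measurable M"
    using assms by (auto simp: indep_bernoulli_def indep_vars_def)
  have "prob ({\<omega> \<in> space M. Z j \<omega> = 0} \<union> {\<omega> \<in> space M. Z j \<omega> = 1}) =
      prob {\<omega> \<in> space M. Z j \<omega> = 0} + prob {\<omega> \<in> space M. Z j \<omega> = 1}"
    by (rule finite_measure_Union) auto
  also have "\<dots> = 1"
    using assms by (simp add: indep_bernoulli_def)
  finally have "prob {\<omega> \<in> space M. Z j \<omega> = 0 \<or> Z j \<omega> = 1} = 1"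
    by (simp add: Un_def conj_disj_distribL)
  then show ?thesis
    by (subst (asm) prob_Collect_eq_1) auto
qed

lemma indep_bernoulli_expectation:
  assumes "indep_bernoulli m f M Z" and "j \<in> {1..m}"
  shows "(\<integral>\<omega>. Z j \<omega> \<partial>M) = f j"
proof -
  interpret prob_space M using assms by (simp add: indep_bernoulli_def)
  have [measurable]: "Z j \<in> borel_measurable M"
    using assms by (auto simp: indep_bernoulli_def indep_vars_def)
  have "(\<integral>\<omega>. Z j \<omega> \<partial>M) = (\<integral>\<omega>. indicat_real {\<omega> \<in> space M. Z j \<omega> = 1} \<omega> \<partial>M)"
  proof (rule integral_cong_AE)
    show "AE \<omega> in M. Z j \<omega> = indicat_real {\<omega> \<in> space M. Z j \<omega> = 1} \<omega>"
      using indep_bernoulli_AE[OF assms] by (auto simp: indicator_def)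
  qed auto
  also have "\<dots> = f j"
    using assms by (simp add: indep_bernoulli_def Int_def conj_commute)
  finally show ?thesis .
qed

text \<open>Almost surely the best offer is t j if Z j = 1 and the best offer R from
  \<open>X\<close> otherwise, that is (1 - Z j) R + t j Z j. Independence of Z j and R factors the
  expectation of the product.\<close>

lemma portfolio_value_insert:
  assumes bern: "indep_bernoulli m f M Z"
    and X: "X \<subseteq> {1..m}" and j: "j \<in> {1..m}" "j \<notin> X"
    and t: "0 \<le> t j" "\<And>i. i \<in> X \<Longrightarrow> t i \<le> t j"
  shows "portfolio_value M Z t (insert j X) = (1 - f j) * portfolio_value M Z t X + f j * t j"
proof -
  interpret prob_space M using bern by (simp add: indep_bernoulli_def)
  have indep: "indep_vars (\<lambda>_. borel) Z {1..m}"
    using bern by (simp add: indep_bernoulli_def)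
  have rv: "Z i \<in> borel_measurable M" if "i \<in> {1..m}" for i
    using indep that by (auto simp: indep_vars_def)
  have fin: "finite X" using X finite_subset by blast
  define R where "R = (\<lambda>\<omega>. Max (insert 0 ((\<lambda>i. t i * Z i \<omega>) ` X)))"
  have [measurable]: "R \<in> borel_measurable M" "Z j \<in> borel_measurable M"
    unfolding R_def using X fin rv j by (auto intro!: borel_measurable_Max_insert_0)
  have AE_X: "AE \<omega> in M. \<forall>i\<in>X. Z i \<omega> = 0 \<or> Z i \<omega> = 1"
    using indep_bernoulli_AE[OF bern] X fin by (auto intro!: AE_finite_allI)
  have AE_j: "AE \<omega> in M. Z j \<omega> = 0 \<or> Z j \<omega> = 1"
    using indep_bernoulli_AE[OF bern j(1)] .
  \<comment> \<open>Holds because each Z i is 0 or 1 and t j is maximal. It makes R integrable and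
    later decides the maximum of t j Z j and R.\<close>
  have AE_R: "AE \<omega> in M. 0 \<le> R \<omega> \<and> R \<omega> \<le> t j"
    using AE_X by eventually_elim (use fin t in \<open>auto simp: R_def\<close>)
  have int_R: "integrable M R"
    by (rule integrable_const_bound[where B = "t j"]) (use AE_R in auto)
  have int_Z: "integrable M (Z j)"
    by (rule integrable_const_bound[where B = 1]) (use AE_j in auto)
  \<comment> \<open>Both variables depend on disjoint groups of the \<open>Z i\<close>, namely
    \<open>{j}\<close> and \<open>X\<close>. The bound variable \<open>f\<close> is an outcome
    vector here, not the admission probabilities.\<close>
  have "indep_var
      borel ((\<lambda>f. 1 - f j) \<circ> (\<lambda>\<omega>. restrict (\<lambda>i. Z i \<omega>) {j}))
      borel ((\<lambda>f. Max (insert 0 ((\<lambda>i. t i * f i) ` X))) \<circ> (\<lambda>\<omega>. restrict (\<lambda>i. Z i \<omega>) X))"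
    using fin j X
    by (intro indep_var_compose[OF indep_var_restrict[OF indep]] borel_measurable_Max_insert_0) auto
  also have "((\<lambda>f. 1 - f j) \<circ> (\<lambda>\<omega>. restrict (\<lambda>i. Z i \<omega>) {j})) = (\<lambda>\<omega>. 1 - Z j \<omega>)"
    by auto
  also have "((\<lambda>f. Max (insert 0 ((\<lambda>i. t i * f i) ` X))) \<circ> (\<lambda>\<omega>. restrict (\<lambda>i. Z i \<omega>) X)) = R"
    by (auto simp: R_def fun_eq_iff cong: image_cong)
  finally have ind: "indep_var borel (\<lambda>\<omega>. 1 - Z j \<omega>) borel R" .
  have int1: "integrable M (\<lambda>\<omega>. 1 - Z j \<omega>)" using int_Z by simp
  have "portfolio_value M Z t (insert j X) = (\<integral>\<omega>. (1 - Z j \<omega>) * R \<omega> + t j * Z j \<omega> \<partial>M)"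
    unfolding portfolio_value_def
  proof (rule integral_cong_AE)
    show "(\<lambda>\<omega>. Max (insert 0 ((\<lambda>i. t i * Z i \<omega>) ` insert j X))) \<in> borel_measurable M"
      using X fin rv j by (intro borel_measurable_Max_insert_0) auto
    have "Max (insert 0 ((\<lambda>i. t i * Z i \<omega>) ` insert j X)) = max (t j * Z j \<omega>) (R \<omega>)" for \<omega>
      using fin by (simp add: R_def insert_commute[of 0])
    then show "AE \<omega> in M. Max (insert 0 ((\<lambda>i. t i * Z i \<omega>) ` insert j X)) =
        (1 - Z j \<omega>) * R \<omega> + t j * Z j \<omega>"
      using AE_R AE_j by auto
  qed simp
  also have "\<dots> = (\<integral>\<omega>. (1 - Z j \<omega>) * R \<omega> \<partial>M) + t j * (\<integral>\<omega>. Z j \<omega> \<partial>M)"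
    using indep_var_integrable[OF ind int1 int_R] int_Z by simp
  also have "(\<integral>\<omega>. (1 - Z j \<omega>) * R \<omega> \<partial>M) = (\<integral>\<omega>. 1 - Z j \<omega> \<partial>M) * (\<integral>\<omega>. R \<omega> \<partial>M)"
    by (rule indep_var_lebesgue_integral[OF ind int1 int_R])
  also have "(\<integral>\<omega>. 1 - Z j \<omega> \<partial>M) = 1 - f j"
    using int_Z indep_bernoulli_expectation[OF bern j(1)] by (simp add: prob_space)
  finally show ?thesis
    using indep_bernoulli_expectation[OF bern j(1)] by (simp add: portfolio_value_def R_def)
qed

subsection \<open>Optimality and running time\<close>

text \<open>\<open>val\<close> carries portfolio values over to the new indices, where each new
  largest index has the largest t, so \<open>portfolio_value_insert\<close> gives the recursion.
  Backtracking attains \<open>opt_value\<close>, which no feasible portfolio exceeds.\<close>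

lemma dynamic_program_optimal:
  fixes M :: "'w measure" and s :: machine
  assumes inst: "ellis_instance m t f g H" and bern: "indep_bernoulli m f M Z"
    and indexing: "nondecreasing_indexing m t (school s)"
  shows "optimal_portfolio M Z m t g H (set (result (dynamic_program m t f g H) s))"
proof -
  define \<sigma> where "\<sigma> = school s"
  have bij: "bij_betw \<sigma> {1..m} {1..m}" and mono: "mono_on {1..m} (\<lambda>j. t (\<sigma> j))"
    using indexing by (auto simp: nondecreasing_indexing_def \<sigma>_def)
  have \<sigma>_in: "\<sigma> j \<in> {1..m}" if "j \<in> {1..m}" for j
    using bij that by (auto simp: bij_betw_def)
  have inj: "inj_on \<sigma> {1..m}" using bij by (simp add: bij_betw_def)
  define val where "val S = portfolio_value M Z t (\<sigma> ` S)" for S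
  have empty: "val {} = 0" by (simp add: val_def portfolio_value_def)
  have insert: "val (insert j S) = (1 - f (\<sigma> j)) * val S + f (\<sigma> j) * t (\<sigma> j)"
    if j: "j \<in> {1..m}" and S: "S \<subseteq> {1..<j}" for j S
    unfolding val_def image_insert
  proof (rule portfolio_value_insert[OF bern _ \<sigma>_in[OF j]])
    have S': "S \<subseteq> {1..m}" "j \<notin> S" using S j by auto
    then show "\<sigma> ` S \<subseteq> {1..m}" using \<sigma>_in by blast
    show "\<sigma> j \<notin> \<sigma> ` S" using inj j S' by (simp add: inj_on_image_mem_iff)
    show "0 \<le> t (\<sigma> j)" using inst \<sigma>_in[OF j] by (auto simp: ellis_instance_def less_imp_le)
    show "t i \<le> t (\<sigma> j)" if "i \<in> \<sigma> ` S" for i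
      using that S S' j by (force intro: mono_onD[OF mono])
  qed
  define s' where "s' = snd (run_state (fill_table m t f g H) s)"
  have school: "school s' = \<sigma>" by (simp add: s'_def \<sigma>_def run_fill_table)
  have "\<And>i. i \<in> {1..m} \<Longrightarrow> 0 < (g \<circ> \<sigma>) i"
    using inst \<sigma>_in by (auto simp: ellis_instance_def)
  then have table: "correct_table m (t \<circ> \<sigma>) (f \<circ> \<sigma>) (\<lambda>i. g (school s' i)) H (V s')"
    using correct_table_fold[of m "g \<circ> \<sigma>" "t \<circ> \<sigma>" "f \<circ> \<sigma>" H "V s"]
    by (simp add: school) (simp add: s'_def run_fill_table \<sigma>_def comp_def)
  have "result (dynamic_program m t f g H) s = fst (run_state (select g m (int H) []) s')"
    by (simp add: result_def dynamic_program_def s'_def split: prod.split)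
  then obtain S where S: "S \<subseteq> {1..m}" "set (result (dynamic_program m t f g H) s) = \<sigma> ` S"
    "int (\<Sum>i\<in>S. g (\<sigma> i)) \<le> int H"
    "val S = opt_value (t \<circ> \<sigma>) (f \<circ> \<sigma>) (\<lambda>i. g (\<sigma> i)) m (int H)"
    using select_correct[of val m "f \<circ> \<sigma>" "t \<circ> \<sigma>" g s' H m "int H" "[]", OF empty _ table] insert
    by (auto simp: school)
  have sum: "(\<Sum>i\<in>\<sigma> ` A. g i) = (\<Sum>i\<in>A. g (\<sigma> i))" if "A \<subseteq> {1..m}" for A
    using inj_on_subset[OF inj that] by (simp add: sum.reindex)
  show ?thesis
    unfolding optimal_portfolio_def S(2)
  proof (intro conjI allI impI)
    show "feasible_portfolio m g H (\<sigma> ` S)"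
      unfolding feasible_portfolio_def sum[OF S(1)] using S(1) \<sigma>_in S(3)[unfolded of_nat_le_iff] by auto
    fix Y assume Y: "feasible_portfolio m g H Y"
    \<comment> \<open>Surjectivity of \<open>\<sigma>\<close> turns any competitor into a set of new
      indices; by injectivity its total cost is unchanged.\<close>
    obtain A where A: "A \<subseteq> {1..m}" "Y = \<sigma> ` A"
      using Y bij by (metis bij_betw_def feasible_portfolio_def subset_imageE)
    then have "int (\<Sum>i\<in>A. g (\<sigma> i)) \<le> int H"
      using Y unfolding of_nat_le_iff by (simp add: feasible_portfolio_def sum)
    then have "val A \<le> opt_value (t \<circ> \<sigma>) (f \<circ> \<sigma>) (\<lambda>i. g (\<sigma> i)) m (int H)"
      using val_le_opt_value[of val m "f \<circ> \<sigma>" "t \<circ> \<sigma>" m A "\<lambda>i. g (\<sigma> i)" "int H"]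
        empty insert inst \<sigma>_in A(1) by (auto simp: ellis_instance_def)
    then show "portfolio_value M Z t Y \<le> portfolio_value M Z t (\<sigma> ` S)"
      using S(4) A(2) by (simp add: val_def)
  qed
qed

lemma algorithm_D_optimal:
  fixes M :: "'w measure" and s :: machine
  assumes "ellis_instance m t f g H" and "indep_bernoulli m f M Z"
  shows "optimal_portfolio M Z m t g H (set (result (algorithm_D m t f g H) s))"
proof -
  obtain \<sigma> k where run: "run_state (index_schools m t) s =
      ((), s\<lparr>school := \<sigma>, steps := steps s + k\<rparr>)" "nondecreasing_indexing m t \<sigma>"
    using run_index_schools by blast
  then have "result (algorithm_D m t f g H) s =
      result (dynamic_program m t f g H) (s\<lparr>school := \<sigma>, steps := steps s + k\<rparr>)"
    by (simp add: result_def algorithm_D_def)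
  then show ?thesis
    using dynamic_program_optimal[OF assms, of "s\<lparr>school := \<sigma>, steps := steps s + k\<rparr>"] run(2)
    by simp
qed

text \<open>For indexing, table and backtracking in turn, 28 = 13 + 4 + 11 is the coefficient of m
  and 9 = 3 + 5 + 1 the constant.\<close>

lemma running_time_algorithm_D:
  "real (running_time (algorithm_D m t f g H) s) \<le>
     14 * (real m * log 2 (real m)) + 19 * (real H * real m) + 28 * real m + 3 * real H + 9"
proof -
  let ?s = "s\<lparr>steps := 0\<rparr>"
  obtain \<sigma> k where run: "run_state (index_schools m t) ?s =
      ((), ?s\<lparr>school := \<sigma>, steps := steps ?s + k\<rparr>)"
    "real k \<le> 14 * (real m * log 2 (real m)) + 13 * real m + 3"
    using run_index_schools by blast
  define s' where "s' = snd (run_state (fill_table m t f g H) (?s\<lparr>school := \<sigma>, steps := k\<rparr>))"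
  have s': "run_state (fill_table m t f g H) (?s\<lparr>school := \<sigma>, steps := k\<rparr>) = ((), s')"
    "steps s' = k + (3 * (H + 1) + 1 + ((19 * H + 4) * m + 1))"
    by (simp_all add: s'_def run_fill_table)
  obtain zs l where sel: "run_state (select g m (int H) []) s' = (zs, s'\<lparr>steps := steps s' + l\<rparr>)"
    "l \<le> 11 * m + 1"
    using run_select by blast
  have "running_time (algorithm_D m t f g H) s =
      k + (3 * (H + 1) + 1 + ((19 * H + 4) * m + 1)) + l"
    using run(1) s' sel(1)
    by (simp add: running_time_def algorithm_D_def dynamic_program_def)
  also have "real \<dots> \<le> 14 * (real m * log 2 (real m)) + 19 * (real H * real m) + 28 * real m + 3 * real H + 9"
  proof -
    have "real l \<le> 11 * real m + 1" using sel(2) by linarith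
    then show ?thesis using run(2) by (simp add: algebra_simps)
  qed
  finally show ?thesis .
qed

text \<open>The second optimality claim shows that ties in \<open>t\<close> may be broken in any
  way.\<close>

theorem theorem8:
  "(\<forall>m t f g H (M :: 'w measure) Z s.
      ellis_instance m t f g H \<and> indep_bernoulli m f M Z \<longrightarrow>
        optimal_portfolio M Z m t g H (set (result (algorithm_D m t f g H) s)) \<and>
        (nondecreasing_indexing m t (school s) \<longrightarrow>
          optimal_portfolio M Z m t g H (set (result (dynamic_program m t f g H) s)))) \<and>
   (\<exists>C. \<forall>m t f g H s.
      ellis_instance m t f g H \<longrightarrow>
        real (running_time (algorithm_D m t f g H) s)
          \<le> C * (real H * real m + real m * log 2 (real m)))"
\<comment> \<open>59 = 19 + 28 + 3 + 9, because m, H and 1 are each at most H m; it also exceeds the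
  14 of the logarithmic term.\<close>
proof (intro conjI allI impI exI[of _ 59])
  fix m t f g H and M :: "'w measure" and Z and s :: machine
  assume "ellis_instance m t f g H \<and> indep_bernoulli m f M Z"
  then show "optimal_portfolio M Z m t g H (set (result (algorithm_D m t f g H) s))"
    by (simp add: algorithm_D_optimal)
next
  fix m t f g H and M :: "'w measure" and Z and s :: machine
  assume "ellis_instance m t f g H \<and> indep_bernoulli m f M Z"
    and "nondecreasing_indexing m t (school s)"
  then show "optimal_portfolio M Z m t g H (set (result (dynamic_program m t f g H) s))"
    by (simp add: dynamic_program_optimal)
next
  fix m t f g H and s :: machine
  assume inst: "ellis_instance m t f g H"
  \<comment> \<open>For m = 0 the total cost would be 0 and could not exceed H.\<close>
  then have "1 \<le> m" "1 \<le> H" by (cases m; auto simp: ellis_instance_def)+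
  then have "real m \<le> real H * real m" "real H \<le> real H * real m" "1 \<le> real m"
    "0 \<le> real m * log 2 (real m)"
    by simp_all
  then show "real (running_time (algorithm_D m t f g H) s)
      \<le> 59 * (real H * real m + real m * log 2 (real m))"
    using running_time_algorithm_D[of m t f g H s] unfolding distrib_left by linarith
qed

end
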